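(* Let $\{\omega_t\}_{t\in\mathbb{N}}$ be a weighted sequence with partial sums $\theta_t=\sum_{i=1}^t\omega_i$, and let $\varphi:\mathcal{P}(\mathbb{N})\to[0,\infty)$ be defined by $$\varphi(A)=\sup_{t\in\mathbb{N}}\frac{|A\cap[1,\theta_t]|}{\theta_t}\qquad\text{for all }A\subseteq\mathbb{N}.$$ Then $\varphi$ is a submeasure on $\mathbb{N}$, and weighted equi-$\mathcal{I}_\varphi$ convergence coincides with weighted equi-statistical convergence; that is, for every compact $K\subset\mathbb{R}$, every sequence $\{f_t\}_{t\in\mathbb{N}}$ in $C(K)$ and every function $f:K\to\mathbb{R}$, the sequence $\{f_t\}$ is weighted equi-$\mathcal{I}_\varphi$ convergent to $f$ on $K$ with respect to $\{\omega_t\}$ if and only if it is weighted equi-statistically convergent to $f$ on $K$ with respect to $\{\omega_t\}$. In particular, when $\omega_t=1$ for each $t\in\mathbb{N}$, weighted equi-$\mathcal{I}_\varphi$ convergence corresponds to equi-statistical convergence.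
   Context: A sequence $\{\omega_t\}_{t\in\mathbb{N}}$ of real numbers is a weighted sequence if there is $\beta>0$ with $\omega_t>\beta$ for all $t\in\mathbb{N}$. $C(K)$ is the space of continuous real-valued functions on the compact set $K\subset\mathbb{R}$. $|E|$ denotes the cardinality of a set $E$. A submeasure on $\mathbb{N}$ is a map $\varphi:\mathcal{P}(\mathbb{N})\to[0,\infty]$ with $\varphi(\varnothing)=0$; $\varphi(A)\le\varphi(B)$ whenever $A\subseteq B$; $\varphi(A\cup B)\le\varphi(A)+\varphi(B)$; and $\varphi(\{t\})<\infty$ for all $t\in\mathbb{N}$. For such $\varphi$, $\mathcal{I}_\varphi=\{A\subseteq\mathbb{N}:\lim_{t\to\infty}\varphi(A\setminus\{1,\dots,t\})=0\}$. Weighted equi-$\mathcal{I}_\varphi$ convergence of $\{f_t\}$ to $f$ on $K$ with respect to $\{\omega_t\}$: for every $\varepsilon>0$, the functions $h_{j,\varepsilon}(x)=\varphi\big(\{t\in\mathbb{N}:\omega_t|f_t(x)-f(x)|>\varepsilon\}\setminus[1,j]\big)$, $x\in K$, converge uniformly on $K$ to the zero function as $j\to\infty$. Weighted equi-statistical convergence of $\{f_t\}$ to $f$ on $K$ with respect to $\{\omega_t\}$: for every $\varepsilon>0$, the functions $g_{j,\varepsilon}(x)=\frac{|\{t\le\theta_j:\ \omega_t|f_t(x)-f(x)|>\varepsilon\}|}{\theta_j}$, $x\in K$, converge uniformly on $K$ to the zero function as $j\to\infty$. Equi-statistical convergence of $\{f_t\}$ to $f$ on $K$: for every $\varepsilon>0$,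 the functions $x\mapsto\frac{|\{t\in\mathbb{N}:|f_t(x)-f(x)|>\varepsilon\}\cap[1,j]|}{j}$ converge uniformly on $K$ to the zero function as $j\to\infty$. *)

theory Defs
  imports "HOL-Analysis.Analysis"
begin

text \<open>The natural numbers of the source start at 1. Sequences are functions on \<^typ>\<open>nat\<close> whose
  value at 0 is never used, and subsets of the natural numbers are subsets of the following set.\<close>

abbreviation pos_nats :: "nat set" where
  "pos_nats \<equiv> {1..}"

definition weighted_sequence :: "(nat \<Rightarrow> real) \<Rightarrow> bool" where
  "weighted_sequence \<omega> \<longleftrightarrow> (\<exists>\<beta>>0. \<forall>t\<in>pos_nats. \<omega> t > \<beta>)"

definition partial_sum :: "(nat \<Rightarrow> real) \<Rightarrow> nat \<Rightarrow> real" where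
  "partial_sum \<omega> t = (\<Sum>i=1..t. \<omega> i)"

definition submeasure :: "(nat set \<Rightarrow> ennreal) \<Rightarrow> bool" where
  "submeasure \<phi> \<longleftrightarrow>
     \<phi> {} = 0 \<and>
     (\<forall>A B. A \<subseteq> B \<longrightarrow> B \<subseteq> pos_nats \<longrightarrow> \<phi> A \<le> \<phi> B) \<and>
     (\<forall>A B. A \<subseteq> pos_nats \<longrightarrow> B \<subseteq> pos_nats \<longrightarrow> \<phi> (A \<union> B) \<le> \<phi> A + \<phi> B) \<and>
     (\<forall>t\<in>pos_nats. \<phi> {t} < \<infinity>)"

text \<open>The endpoint of the interval $[1,\theta_t]$ is a real number, hence the coercion.\<close>

definition weight_submeasure :: "(nat \<Rightarrow> real) \<Rightarrow> nat set \<Rightarrow> ennreal" where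
  "weight_submeasure \<omega> A =
     (SUP t\<in>pos_nats.
        ennreal (real (card {n \<in> A. 1 \<le> n \<and> real n \<le> partial_sum \<omega> t}) / partial_sum \<omega> t))"

text \<open>A submeasure may take the value \<open>\<infinity>\<close> and \<^typ>\<open>ennreal\<close> carries no metric in the library, so
  \<^const>\<open>uniform_limit\<close> is not available here and uniform convergence to the zero function is
  spelled out.\<close>

definition weighted_equi_ideal_convergent ::
  "(nat set \<Rightarrow> ennreal) \<Rightarrow> (nat \<Rightarrow> real) \<Rightarrow> real set \<Rightarrow> (nat \<Rightarrow> real \<Rightarrow> real) \<Rightarrow> (real \<Rightarrow> real) \<Rightarrow> bool"
where
  "weighted_equi_ideal_convergent \<phi> \<omega> K F f \<longleftrightarrow>
     (\<forall>\<epsilon>>0. \<forall>\<delta>>0. \<forall>\<^sub>F j in sequentially. \<forall>x\<in>K.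
        \<phi> ({t \<in> pos_nats. \<omega> t * \<bar>F t x - f x\<bar> > \<epsilon>} - {1..j}) < \<delta>)"

definition weighted_equi_statistically_convergent ::
  "(nat \<Rightarrow> real) \<Rightarrow> real set \<Rightarrow> (nat \<Rightarrow> real \<Rightarrow> real) \<Rightarrow> (real \<Rightarrow> real) \<Rightarrow> bool"
where
  "weighted_equi_statistically_convergent \<omega> K F f \<longleftrightarrow>
     (\<forall>\<epsilon>>0. uniform_limit K
        (\<lambda>j x. real (card {t \<in> pos_nats. real t \<le> partial_sum \<omega> j \<and> \<omega> t * \<bar>F t x - f x\<bar> > \<epsilon>})
                 / partial_sum \<omega> j)
        (\<lambda>x. 0) sequentially)"

definition equi_statistically_convergent ::
  "real set \<Rightarrow> (nat \<Rightarrow> real \<Rightarrow> real) \<Rightarrow> (real \<Rightarrow> real) \<Rightarrow> bool"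
where
  "equi_statistically_convergent K F f \<longleftrightarrow>
     (\<forall>\<epsilon>>0. uniform_limit K
        (\<lambda>j x. real (card ({t \<in> pos_nats. \<bar>F t x - f x\<bar> > \<epsilon>} \<inter> {1..j})) / real j)
        (\<lambda>x. 0) sequentially)"

end

theory Submission imports Defs begin

text \<open>Write $\theta_t$ for the partial sums; they increase, and they tend to infinity because the
  weights exceed a positive constant. The value $\varphi(A)$ is the supremum over $t \ge 1$ of the density of
  \<open>A\<close> in $[1,\theta_t]$. Each density is monotone and subadditive in \<open>A\<close> and at most 1, so $\varphi$
  is a submeasure that is bounded by 1.

  The two modes of convergence are compared for an arbitrary family of sets $E_x$, $x \in K$, by two
  estimates that are uniform in \<open>x\<close>. On the one hand, removing $\{1,\dots,m\}$ from $E_x$ changes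
  its density in $[1,\theta_j]$ by at most $m/\theta_j$, so
  \[ \frac{|E_x \cap [1,\theta_j]|}{\theta_j} \le \frac{m}{\theta_j} + \varphi(E_x \setminus \{1,\dots,m\}), \]
  and $m/\theta_j \to 0$ for fixed \<open>m\<close>. On the other hand, if $m \ge \theta_N$ then
  $E_x \setminus \{1,\dots,m\}$ does not meet $[1,\theta_t]$ for $t \le N$, so that only the indices
  $t > N$ contribute to the supremum $\varphi(E_x \setminus \{1,\dots,m\})$. A uniform bound on the
  densities of $E_x$ from the index \<open>N\<close> on is therefore also a bound on this value. This is
  \<open>ideal_smallness_iff_uniform_density\<close>; the proposition is the case
  $E_x = \{t : \omega_t |f_t(x) - f(x)| > \varepsilon\}$. With unit weights $\theta_j = j$, and weighted
  equi-statistical convergence is equi-statistical convergence.\<close>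

definition initial_density :: "real \<Rightarrow> nat set \<Rightarrow> real" where
  "initial_density s A = real (card {n \<in> A. 1 \<le> n \<and> real n \<le> s}) / s"

lemma finite_initial_segment: "finite {n \<in> A. 1 \<le> n \<and> real n \<le> s}"
proof (rule finite_subset)
  show "{n \<in> A. 1 \<le> n \<and> real n \<le> s} \<subseteq> {1..nat \<lfloor>s\<rfloor>}"
    by (auto simp: le_nat_floor)
qed simp

lemma initial_density_nonneg: "0 \<le> s \<Longrightarrow> 0 \<le> initial_density s A"
  by (simp add: initial_density_def)

lemma initial_density_mono:
  assumes "0 \<le> s" and "A \<subseteq> B"
  shows "initial_density s A \<le> initial_density s B"
  unfolding initial_density_def
  using assms by (intro divide_right_mono of_nat_mono card_mono finite_initial_segment) auto

lemma initial_density_Un_le: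
  assumes "0 \<le> s"
  shows "initial_density s (A \<union> B) \<le> initial_density s A + initial_density s B"
proof -
  have "{n \<in> A \<union> B. 1 \<le> n \<and> real n \<le> s}
      = {n \<in> A. 1 \<le> n \<and> real n \<le> s} \<union> {n \<in> B. 1 \<le> n \<and> real n \<le> s}"
    by auto
  then have "real (card {n \<in> A \<union> B. 1 \<le> n \<and> real n \<le> s})
      \<le> real (card {n \<in> A. 1 \<le> n \<and> real n \<le> s}) + real (card {n \<in> B. 1 \<le> n \<and> real n \<le> s})"
    using card_Un_le by (simp flip: of_nat_add)
  from divide_right_mono[OF this assms] show ?thesis
    by (simp add: initial_density_def add_divide_distrib)
qed

lemma initial_density_le_1:
  assumes "0 \<le> s"
  shows "initial_density s A \<le> 1"
proof -
  have "card {n \<in> A. 1 \<le> n \<and> real n \<le> s} \<le> card {1..nat \<lfloor>s\<rfloor>}"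
    by (intro card_mono) (auto simp: le_nat_floor)
  then have "real (card {n \<in> A. 1 \<le> n \<and> real n \<le> s}) \<le> s"
    using assms of_nat_floor[OF assms] by simp
  then show ?thesis
    using assms by (auto simp: initial_density_def divide_le_eq_1)
qed

lemma initial_density_atLeastAtMost_le:
  assumes "0 \<le> s"
  shows "initial_density s {1..m} \<le> real m / s"
proof -
  have "card {n \<in> {1..m}. 1 \<le> n \<and> real n \<le> s} \<le> card {1..m}"
    by (intro card_mono) auto
  then show ?thesis
    unfolding initial_density_def using assms by (intro divide_right_mono) simp_all
qed

lemma initial_density_Diff_eq_0:
  assumes "s \<le> real m"
  shows "initial_density s (A - {1..m}) = 0"
proof -
  have "{n \<in> A - {1..m}. 1 \<le> n \<and> real n \<le> s} = {}"
    using assms by auto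
  then show ?thesis
    unfolding initial_density_def by (metis card.empty div_0 of_nat_0)
qed

lemma partial_sum_mono:
  assumes "weighted_sequence \<omega>" and "s \<le> t"
  shows "partial_sum \<omega> s \<le> partial_sum \<omega> t"
proof -
  have "0 \<le> \<omega> i" if "1 \<le> i" for i
    using assms(1) that unfolding weighted_sequence_def by (meson atLeast_iff less_le_trans less_imp_le)
  then show ?thesis
    unfolding partial_sum_def using assms(2) by (intro sum_mono2) auto
qed

lemma partial_sum_nonneg: "weighted_sequence \<omega> \<Longrightarrow> 0 \<le> partial_sum \<omega> t"
  using partial_sum_mono[of \<omega> 0 t] by (simp add: partial_sum_def)

lemma partial_sum_at_top:
  assumes "weighted_sequence \<omega>"
  shows "filterlim (partial_sum \<omega>) at_top sequentially"
proof -
  obtain \<beta> where \<beta>: "\<beta> > 0" "\<And>t. 1 \<le> t \<Longrightarrow> \<beta> < \<omega> t"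
    using assms by (auto simp: weighted_sequence_def)
  have linear: "filterlim (\<lambda>t. \<beta> * real t) at_top sequentially"
    by (intro filterlim_tendsto_pos_mult_at_top[OF tendsto_const \<beta>(1)] filterlim_real_sequentially)
  have bound: "\<beta> * real t \<le> partial_sum \<omega> t" for t
  proof -
    have "(\<Sum>i=1..t. \<beta>) \<le> (\<Sum>i=1..t. \<omega> i)"
      using \<beta>(2) by (intro sum_mono) (auto intro: less_imp_le)
    then show ?thesis
      by (simp add: partial_sum_def mult.commute)
  qed
  show ?thesis
    by (rule filterlim_at_top_mono[OF linear]) (simp add: bound)
qed

lemma weight_submeasure_eq_SUP:
  "weight_submeasure \<omega> A = (SUP t\<in>pos_nats. ennreal (initial_density (partial_sum \<omega> t) A))"
  by (simp add: weight_submeasure_def initial_density_def)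

lemma weight_submeasure_less_infinity:
  assumes "weighted_sequence \<omega>"
  shows "weight_submeasure \<omega> A < \<infinity>"
proof -
  have "weight_submeasure \<omega> A \<le> 1"
    unfolding weight_submeasure_eq_SUP
    using partial_sum_nonneg[OF assms] by (intro SUP_least) (simp add: initial_density_le_1)
  also have "\<dots> < \<infinity>"
    by simp
  finally show ?thesis .
qed

lemma submeasure_weight_submeasure:
  assumes "weighted_sequence \<omega>"
  shows "submeasure (weight_submeasure \<omega>)"
proof -
  note nn = partial_sum_nonneg[OF assms]
  have "weight_submeasure \<omega> {} = 0"
    by (simp add: weight_submeasure_def)
  moreover have "weight_submeasure \<omega> A \<le> weight_submeasure \<omega> B" if "A \<subseteq> B" for A B
    unfolding weight_submeasure_eq_SUP
    using that by (intro SUP_mono' ennreal_leI initial_density_mono nn)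
  moreover have "weight_submeasure \<omega> (A \<union> B) \<le> weight_submeasure \<omega> A + weight_submeasure \<omega> B" for A B
    unfolding weight_submeasure_eq_SUP
  proof (rule SUP_least)
    fix t assume t: "t \<in> pos_nats"
    let ?d = "initial_density (partial_sum \<omega> t)"
    have "ennreal (?d (A \<union> B)) \<le> ennreal (?d A + ?d B)"
      by (intro ennreal_leI initial_density_Un_le nn)
    also have "\<dots> = ennreal (?d A) + ennreal (?d B)"
      by (intro ennreal_plus initial_density_nonneg nn)
    also have "\<dots> \<le> (SUP t\<in>pos_nats. ennreal (initial_density (partial_sum \<omega> t) A))
                + (SUP t\<in>pos_nats. ennreal (initial_density (partial_sum \<omega> t) B))"
      using t by (intro add_mono SUP_upper)
    finally show "ennreal (?d (A \<union> B)) \<le> \<dots>" .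
  qed
  moreover have "weight_submeasure \<omega> A < \<infinity>" for A
    by (rule weight_submeasure_less_infinity[OF assms])
  ultimately show ?thesis
    unfolding submeasure_def by blast
qed

text \<open>Both directions apply to any family of sets, because the only error terms, $m/\theta_j$ for
  removing an initial segment and the threshold $m \ge \theta_N$ that silences the first \<open>N\<close>
  densities, come from the weights and are the same for all \<open>x\<close>.\<close>

lemma ideal_smallness_iff_uniform_density:
  fixes E :: "'a \<Rightarrow> nat set"
  assumes "weighted_sequence \<omega>"
  shows "(\<forall>\<delta>>0. \<forall>\<^sub>F j in sequentially. \<forall>x\<in>K. weight_submeasure \<omega> (E x - {1..j}) < \<delta>)
     \<longleftrightarrow> uniform_limit K (\<lambda>j x. initial_density (partial_sum \<omega> j) (E x)) (\<lambda>x. 0) sequentially"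
    (is "?ideal \<longleftrightarrow> ?density")
proof
  note nn = partial_sum_nonneg[OF assms]
  assume ?ideal
  show ?density
  proof (rule uniform_limitI)
    fix e :: real assume "e > 0"
    then have "0 < ennreal (e / 2)"
      by simp
    with \<open>?ideal\<close> have "\<forall>\<^sub>F m in sequentially. \<forall>x\<in>K. weight_submeasure \<omega> (E x - {1..m}) < ennreal (e / 2)"
      by blast
    then obtain m where m: "\<And>x. x \<in> K \<Longrightarrow> weight_submeasure \<omega> (E x - {1..m}) < ennreal (e / 2)"
      by (auto simp: eventually_sequentially)
    have "((\<lambda>j. real m / partial_sum \<omega> j) \<longlongrightarrow> 0) sequentially"
      by (rule real_tendsto_divide_at_top[OF tendsto_const partial_sum_at_top[OF assms]])
    then have "\<forall>\<^sub>F j in sequentially. real m / partial_sum \<omega> j < e / 2"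
      by (rule order_tendstoD(2)) (use \<open>e > 0\<close> in simp)
    then show "\<forall>\<^sub>F j in sequentially. \<forall>x\<in>K. dist (initial_density (partial_sum \<omega> j) (E x)) 0 < e"
      using eventually_ge_at_top[of 1]
    proof eventually_elim
      case (elim j)
      show ?case
      proof
        fix x assume x: "x \<in> K"
        let ?d = "initial_density (partial_sum \<omega> j)"
        have "ennreal (?d (E x - {1..m})) \<le> weight_submeasure \<omega> (E x - {1..m})"
          unfolding weight_submeasure_eq_SUP using elim(2) by (intro SUP_upper) simp
        also note m[OF x]
        finally have "?d (E x - {1..m}) < e / 2"
          by (simp add: ennreal_less_iff initial_density_nonneg nn)
        moreover have "?d {1..m} < e / 2"
          using initial_density_atLeastAtMost_le[OF nn, of j m] elim(1) by linarith
        moreover have "?d (E x) \<le> ?d ((E x - {1..m}) \<union> {1..m})"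
          by (intro initial_density_mono nn) auto
        moreover have "\<dots> \<le> ?d (E x - {1..m}) + ?d {1..m}"
          by (rule initial_density_Un_le[OF nn])
        ultimately have "?d (E x) < e"
          by linarith
        then show "dist (?d (E x)) 0 < e"
          using initial_density_nonneg[OF nn, of j "E x"] by simp
      qed
    qed
  qed
next
  note nn = partial_sum_nonneg[OF assms]
  assume ?density
  show ?ideal
  proof (intro allI impI)
    fix \<delta> :: ennreal assume "\<delta> > 0"
    \<comment> \<open>A bound on every density only gives a weak inequality for the supremum, and \<open>\<delta>\<close> may be
      infinite; a finite bound strictly below \<open>\<delta>\<close> settles both.\<close>
    obtain d' where d': "0 < d'" "d' < \<delta>"
      using dense[OF \<open>\<delta> > 0\<close>] by blast
    define d where "d = enn2real d'"
    have "d' < top"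
      using d'(2) by (rule less_le_trans) simp
    then have d: "0 < d" "ennreal d < \<delta>"
      using d' by (simp_all add: d_def enn2real_positive_iff)
    from uniform_limitD[OF \<open>?density\<close> d(1)] obtain N where
      N: "\<And>t x. N \<le> t \<Longrightarrow> x \<in> K \<Longrightarrow> dist (initial_density (partial_sum \<omega> t) (E x)) 0 < d"
      by (auto simp: eventually_sequentially)
    have "\<forall>\<^sub>F m in sequentially. partial_sum \<omega> N \<le> real m"
      using filterlim_real_sequentially by (simp add: filterlim_at_top)
    then show "\<forall>\<^sub>F m in sequentially. \<forall>x\<in>K. weight_submeasure \<omega> (E x - {1..m}) < \<delta>"
    proof eventually_elim
      case (elim m)
      show ?case
      proof
        fix x assume x: "x \<in> K"
        have "initial_density (partial_sum \<omega> t) (E x - {1..m}) \<le> d" for t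
        proof (cases "t \<le> N")
          case True
          then have "partial_sum \<omega> t \<le> real m"
            using partial_sum_mono[OF assms True] elim by linarith
          then show ?thesis
            using d(1) by (simp only: initial_density_Diff_eq_0)
        next
          case False
          then have "initial_density (partial_sum \<omega> t) (E x) < d"
            using N[OF _ x, of t] by (simp add: dist_real_def)
          moreover have "initial_density (partial_sum \<omega> t) (E x - {1..m})
              \<le> initial_density (partial_sum \<omega> t) (E x)"
            by (intro initial_density_mono nn) auto
          ultimately show ?thesis
            by linarith
        qed
        then have "weight_submeasure \<omega> (E x - {1..m}) \<le> ennreal d"
          unfolding weight_submeasure_eq_SUP by (intro SUP_least ennreal_leI)
        then show "weight_submeasure \<omega> (E x - {1..m}) < \<delta>"
          using d(2) by (rule le_less_trans)
      qed
    qed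
  qed
qed

lemma weighted_equi_ideal_iff_statistically_convergent:
  assumes "weighted_sequence \<omega>"
  shows "weighted_equi_ideal_convergent (weight_submeasure \<omega>) \<omega> K F f
     \<longleftrightarrow> weighted_equi_statistically_convergent \<omega> K F f"
proof -
  have "real (card {t \<in> pos_nats. real t \<le> partial_sum \<omega> j \<and> \<omega> t * \<bar>F t x - f x\<bar> > \<epsilon>})
          / partial_sum \<omega> j
      = initial_density (partial_sum \<omega> j) {t \<in> pos_nats. \<omega> t * \<bar>F t x - f x\<bar> > \<epsilon>}" for \<epsilon> j x
    unfolding initial_density_def
    by (intro arg_cong2[where f = "(/)"] arg_cong[where f = real] arg_cong[where f = card]) auto
  then show ?thesis
    unfolding weighted_equi_ideal_convergent_def weighted_equi_statistically_convergent_def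
    by (simp only: ideal_smallness_iff_uniform_density[OF assms])
qed

lemma weighted_equi_statistically_convergent_unit_weights:
  assumes "\<forall>t\<in>pos_nats. \<omega> t = 1"
  shows "weighted_equi_statistically_convergent \<omega> K F f \<longleftrightarrow> equi_statistically_convergent K F f"
proof -
  have endpoint: "partial_sum \<omega> j = real j" for j
    using assms by (simp add: partial_sum_def)
  have level_set: "{t \<in> pos_nats. real t \<le> real j \<and> \<omega> t * \<bar>F t x - f x\<bar> > \<epsilon>}
      = {t \<in> pos_nats. \<bar>F t x - f x\<bar> > \<epsilon>} \<inter> {1..j}" for \<epsilon> j x
    using assms by auto
  show ?thesis
    unfolding weighted_equi_statistically_convergent_def equi_statistically_convergent_def
      endpoint level_set ..
qed

theorem proposition5p2:
  fixes \<omega> :: "nat \<Rightarrow> real"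
  assumes "weighted_sequence \<omega>"
  shows "(\<forall>A \<subseteq> pos_nats. weight_submeasure \<omega> A < \<infinity>)
    \<and> submeasure (weight_submeasure \<omega>)
    \<and> (\<forall>(K :: real set) (F :: nat \<Rightarrow> real \<Rightarrow> real) (f :: real \<Rightarrow> real).
         compact K \<longrightarrow> (\<forall>t\<in>pos_nats. continuous_on K (F t)) \<longrightarrow>
         (weighted_equi_ideal_convergent (weight_submeasure \<omega>) \<omega> K F f
            \<longleftrightarrow> weighted_equi_statistically_convergent \<omega> K F f))
    \<and> ((\<forall>t\<in>pos_nats. \<omega> t = 1) \<longrightarrow>
         (\<forall>(K :: real set) (F :: nat \<Rightarrow> real \<Rightarrow> real) (f :: real \<Rightarrow> real).
            compact K \<longrightarrow> (\<forall>t\<in>pos_nats. continuous_on K (F t)) \<longrightarrow>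
            (weighted_equi_ideal_convergent (weight_submeasure \<omega>) \<omega> K F f
               \<longleftrightarrow> equi_statistically_convergent K F f)))"
proof (intro conjI allI impI)
  show "weight_submeasure \<omega> A < \<infinity>" for A
    by (rule weight_submeasure_less_infinity[OF assms])
  show "submeasure (weight_submeasure \<omega>)"
    by (rule submeasure_weight_submeasure[OF assms])
  show "weighted_equi_ideal_convergent (weight_submeasure \<omega>) \<omega> K F f
      \<longleftrightarrow> weighted_equi_statistically_convergent \<omega> K F f" for K F f
    by (rule weighted_equi_ideal_iff_statistically_convergent[OF assms])
  then show "weighted_equi_ideal_convergent (weight_submeasure \<omega>) \<omega> K F f
      \<longleftrightarrow> equi_statistically_convergent K F f" if "\<forall>t\<in>pos_nats. \<omega> t = 1" for K F f
    by (simp only: weighted_equi_statistically_convergent_unit_weights[OF that])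
qed

end
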